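(* Let $G$ and $H$ be simultaneous combinatorial games, played under the scoring winning convention and combined with the continued conjunctive sum $\bigtriangledown$. Then 1. $Ex(G\bigtriangledown H)=Ex(G)+Ex(H)$; 2. $G\geq H$ if $Ex(G)\geq Ex(H)$.
   Context: A simultaneous combinatorial game is a position $G$ with a set of Left options ${}^{L_i}G$ (Left's pure strategies), a set of Right options $G^{R_j}$ (Right's pure strategies), and a set of simultaneous options ${}^{L_i}G^{R_j}$, where ${}^{L_i}G^{R_j}$ is the result of Left playing pure strategy $i$ and Right playing pure strategy $j$ at the same time. Play has perfect information and terminates in finitely many moves. $G$ is terminal if it has no simultaneous options. $M(G)$ is the matrix whose rows are Left's pure strategies, whose columns are Right's pure strategies and whose entries are the ${}^{L_i}G^{R_j}$. Scoring convention: a terminal position $G$ has a score $\mathrm{score}_G$ (an integer); Left wins if $\mathrm{score}_G>0$, Right wins if $\mathrm{score}_G<0$, and otherwise the game is a Draw. Expected value: $Ex(G)$ is defined recursively by $Ex(G)=1$ if $G$ is terminal and a Left win, $Ex(G)=0$ if $G$ is terminal and a Draw, $Ex(G)=-1$ if $G$ is terminal and a Right win, and otherwise $Ex(G)=Ex(M'(G))$, the value (in mixed strategies) of the two-player zero-sum matrix game $M'(G)$ obtained from $M(G)$ by replacing each entry ${}^{L_i}G^{R_j}$ by $Ex({}^{L_i}G^{R_j})$, with Left the maximizing row player and Right the minimizing column player. Continued conjunctive sum under scoring play: in $G\bigtriangledown H$ each player plays a legal move in all components where both players have moves. The options are the positions ${}^{L}G^{R}\bigtriangledown{}^{L}H^{R}$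 if $G$ or $H$ has a simultaneous option (a component in which there is no simultaneous move is left as it is); if $G\bigtriangledown H$ is terminal, its score is $\mathrm{score}_G+\mathrm{score}_H$. Order: $G\geq H$ means that for every game $X$, $\alpha(G\bigtriangledown X)\geq\alpha(H\bigtriangledown X)$, where $\alpha$ is the measure of winning in use, here $\alpha=Ex$.
   Formalization: Ex here is the expected score: a terminal position pays score_G instead of 1, 0 or -1, also in the order. With payoffs 1, 0, -1 both parts fail: two terminal games of score 1 have Ex(G▽H)=1, not 2; scores 1, 2 with X of score -1 refute part 2. *)

theory Defs
  imports "HOL-Probability.Probability"
begin

section \<open>Simultaneous combinatorial games\<close>

text \<open>
  Left's pure strategies in \<open>G\<close> are the indices \<open>i < length (left_opts G)\<close>, with
  \<open>left_opts G ! i\<close> the Left option; likewise for Right. The simultaneous option for strategies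
  \<open>i\<close> and \<open>j\<close> is \<open>sim_opt G i j\<close>; values of \<open>sim_opt G\<close> at indices out of range are not part of the
  game. Likewise \<open>score\<close> is meaningful only at terminal positions.
  \<open>End s\<close> is the same game as \<open>Game [] [] M s\<close>; the constructor is there because the datatype would
  otherwise be empty, \<open>sim_opt\<close> being a total function. A \<open>Game\<close> in which at least one player has no
  strategy is terminal too. The type contains only games that terminate.
\<close>
datatype game =
    End (score: int)
  | Game (left_opts: "game list") (right_opts: "game list")
      (sim_opt: "nat \<Rightarrow> nat \<Rightarrow> game") (score: int)
where
    "left_opts (End s) = []"
  | "right_opts (End s) = []"
  | "sim_opt (End s) = (\<lambda>_ _. End s)"

definition sim_opts :: "game \<Rightarrow> game set" where
  "sim_opts G = {sim_opt G i j |i j. i < length (left_opts G) \<and> j < length (right_opts G)}"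

definition terminal :: "game \<Rightarrow> bool" where
  "terminal G \<longleftrightarrow> sim_opts G = {}"


section \<open>Matrix games and expected value\<close>

definition mixed_strategies :: "nat \<Rightarrow> nat pmf set" where
  "mixed_strategies n = {p. set_pmf p \<subseteq> {..<n}}"

definition expected_payoff :: "(nat \<Rightarrow> nat \<Rightarrow> real) \<Rightarrow> nat pmf \<Rightarrow> nat pmf \<Rightarrow> real" where
  "expected_payoff A p q = measure_pmf.expectation (pair_pmf p q) (\<lambda>(i, j). A i j)"

text \<open>
  The value of the \<open>m\<close> by \<open>n\<close> zero-sum game \<open>A\<close>, the row player maximizing; by von Neumann's
  theorem the two optimizations can be interchanged when \<open>m\<close> and \<open>n\<close> are positive.
\<close>
definition matrix_game_value :: "nat \<Rightarrow> nat \<Rightarrow> (nat \<Rightarrow> nat \<Rightarrow> real) \<Rightarrow> real" where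
  "matrix_game_value m n A =
     (SUP p \<in> mixed_strategies m. INF q \<in> mixed_strategies n. expected_payoff A p q)"

text \<open>The recursion for the expected value, where a terminal position of score \<open>s\<close> pays \<open>u s\<close>.\<close>
primrec expected_value :: "(int \<Rightarrow> real) \<Rightarrow> game \<Rightarrow> real" where
  "expected_value u (End s) = u s"
| "expected_value u (Game ls rs M s) =
     (if terminal (Game ls rs M s) then u s
      else matrix_game_value (length ls) (length rs) (\<lambda>i j. expected_value u (M i j)))"

text \<open>
  \<open>Ex_outcome\<close> pays 1 for a Left win, 0 for a Draw and -1 for a Right win, as in the original
  definition of the expected value. With these payoffs the theorem about the sum is false; see
  \<open>Ex_outcome_not_additive\<close> and \<open>Ex_outcome_not_monotone\<close>. It is therefore stated for \<open>Ex\<close>, which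
  pays the score itself, that is, for the expected score.
\<close>
definition Ex_outcome :: "game \<Rightarrow> real" where
  "Ex_outcome = expected_value (\<lambda>s. if s > 0 then 1 else if s < 0 then -1 else 0)"

definition Ex :: "game \<Rightarrow> real" where
  "Ex = expected_value real_of_int"


section \<open>Continued conjunctive sum under scoring play\<close>

inductive_set subposition :: "(game \<times> game) set" where
  "G \<in> set (left_opts H) \<Longrightarrow> (G, H) \<in> subposition"
| "G \<in> set (right_opts H) \<Longrightarrow> (G, H) \<in> subposition"
| "\<not> terminal H \<Longrightarrow> (sim_opt H i j, H) \<in> subposition"

lemma wf_subposition: "wf subposition"
proof (rule wfUNIVI)
  fix P and G :: game
  assume ih: "\<forall>G. (\<forall>H. (H, G) \<in> subposition \<longrightarrow> P H) \<longrightarrow> P G"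
  show "P G"
  proof (induction G)
    case (End s)
    have "P H" if "(H, End s) \<in> subposition" for H
      using that by cases (auto simp: terminal_def sim_opts_def)
    with ih show ?case by blast
  next
    case (Game ls rs M s)
    have "P H" if "(H, Game ls rs M s) \<in> subposition" for H
      using that by cases (auto intro: Game)
    with ih show ?case by blast
  qed
qed

text \<open>
  If neither \<open>G\<close> nor \<open>H\<close> is terminal, a pure strategy in the sum is a pair of pure strategies. Such
  a pair \<open>(i, k)\<close> is numbered \<open>i * n + k\<close>, with \<open>n\<close> the number of strategies in \<open>H\<close>; this agrees with
  the order of \<open>List.product\<close>.
\<close>
function conj_sum :: "game \<Rightarrow> game \<Rightarrow> game"  (infixl \<open>\<bigtriangledown>\<close> 65) where
  "G \<bigtriangledown> H =
    (if terminal G \<and> terminal H then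
       End (score G + score H)
     else if terminal H then
       Game (map (\<lambda>g. g \<bigtriangledown> H) (left_opts G)) (map (\<lambda>g. g \<bigtriangledown> H) (right_opts G))
         (\<lambda>i j. sim_opt G i j \<bigtriangledown> H) (score G + score H)
     else if terminal G then
       Game (map (\<lambda>h. G \<bigtriangledown> h) (left_opts H)) (map (\<lambda>h. G \<bigtriangledown> h) (right_opts H))
         (\<lambda>i j. G \<bigtriangledown> sim_opt H i j) (score G + score H)
     else
       Game (map (\<lambda>(g, h). g \<bigtriangledown> h) (List.product (left_opts G) (left_opts H)))
         (map (\<lambda>(g, h). g \<bigtriangledown> h) (List.product (right_opts G) (right_opts H)))
         (\<lambda>i j. sim_opt G (i div length (left_opts H)) (j div length (right_opts H)) \<bigtriangledown>
                sim_opt H (i mod length (left_opts H)) (j mod length (right_opts H)))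
         (score G + score H))"
  by pat_completeness auto
termination
  by (relation "subposition <*lex*> subposition")
     (auto intro: wf_lex_prod wf_subposition subposition.intros)

declare conj_sum.simps [simp del]


section \<open>Order\<close>

text \<open>\<open>\<alpha>\<close> is the measure of winning in use.\<close>
definition game_ge :: "(game \<Rightarrow> real) \<Rightarrow> game \<Rightarrow> game \<Rightarrow> bool" where
  "game_ge \<alpha> G H \<longleftrightarrow> (\<forall>X. \<alpha> (G \<bigtriangledown> X) \<ge> \<alpha> (H \<bigtriangledown> X))"


section \<open>Win-draw-loss payoffs\<close>

lemma End_sum: "End s \<bigtriangledown> End t = End (s + t)"
  by (subst conj_sum.simps) (simp add: terminal_def sim_opts_def)

lemma Ex_outcome_End:
  "Ex_outcome (End s) = (if s > 0 then 1 else if s < 0 then -1 else 0)"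
  by (simp add: Ex_outcome_def terminal_def sim_opts_def)

lemma Ex_outcome_not_additive:
  "\<not> (\<forall>G H. Ex_outcome (G \<bigtriangledown> H) = Ex_outcome G + Ex_outcome H)"
proof
  assume "\<forall>G H. Ex_outcome (G \<bigtriangledown> H) = Ex_outcome G + Ex_outcome H"
  from this[rule_format, of "End 1" "End 1"] show False
    by (simp only: End_sum Ex_outcome_End) simp
qed

lemma Ex_outcome_not_monotone:
  "\<not> (\<forall>G H. Ex_outcome G \<ge> Ex_outcome H \<longrightarrow> game_ge Ex_outcome G H)"
proof
  assume "\<forall>G H. Ex_outcome G \<ge> Ex_outcome H \<longrightarrow> game_ge Ex_outcome G H"
  from this[rule_format, of "End 2" "End 1"]
  have "game_ge Ex_outcome (End 1) (End 2)"
    by (simp only: Ex_outcome_End) simp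
  then have "Ex_outcome (End 1 \<bigtriangledown> End (-1)) \<ge>
             Ex_outcome (End 2 \<bigtriangledown> End (-1))"
    unfolding game_ge_def by blast
  then show False
    by (simp only: End_sum Ex_outcome_End) simp
qed

end

(*
  If the simultaneous moves of the sum are pairs of moves of the components and its payoffs are
  sums of payoffs, then the expected payoff of a mixed strategy of the sum depends only on its two
  marginals, and every pair of marginals occurs (for the product strategy). Hence infimum and
  supremum split componentwise, and the value of the sum is the sum of the values; the minimax
  theorem is not needed. A finished component contributes a constant, that is, a 1 by 1 matrix.
*)
theory Submission imports Defs begin

text \<open>A real \<open>SUP\<close> has its meaning only for nonempty sets bounded above, whence
  the hypotheses. If \<open>y\<close> bounds every sum \<open>f a + g b\<close>, fixing
  \<open>a\<close> bounds the supremum of \<open>g\<close> by \<open>y - f a\<close>; letting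
  \<open>a\<close> vary then bounds the supremum of \<open>f\<close>.\<close>

lemma cSUP_add_Times:
  fixes f :: "'a \<Rightarrow> real" and g :: "'b \<Rightarrow> real"
  assumes "A \<noteq> {}" "B \<noteq> {}" "bdd_above (f ` A)" "bdd_above (g ` B)"
  shows "(SUP (a, b) \<in> A \<times> B. f a + g b) = (SUP a\<in>A. f a) + (SUP b\<in>B. g b)"
proof (rule cSup_eq_non_empty)
  fix y assume y: "\<And>x. x \<in> (\<lambda>(a, b). f a + g b) ` (A \<times> B) \<Longrightarrow> x \<le> y"
  have "(SUP b\<in>B. g b) \<le> y - f a" if "a \<in> A" for a
    using y that by (intro cSUP_least assms) (force simp: algebra_simps)
  then have "(SUP a\<in>A. f a) \<le> y - (SUP b\<in>B. g b)"
    by (intro cSUP_least assms) (force simp: algebra_simps)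
  then show "(SUP a\<in>A. f a) + (SUP b\<in>B. g b) \<le> y" by simp
qed (use assms in \<open>auto intro!: add_mono cSUP_upper\<close>)

lemma cINF_add_Times:
  fixes f :: "'a \<Rightarrow> real" and g :: "'b \<Rightarrow> real"
  assumes "A \<noteq> {}" "B \<noteq> {}" "bdd_below (f ` A)" "bdd_below (g ` B)"
  shows "(INF (a, b) \<in> A \<times> B. f a + g b) = (INF a\<in>A. f a) + (INF b\<in>B. g b)"
proof (rule cInf_eq_non_empty)
  fix y assume y: "\<And>x. x \<in> (\<lambda>(a, b). f a + g b) ` (A \<times> B) \<Longrightarrow> y \<le> x"
  have "y - f a \<le> (INF b\<in>B. g b)" if "a \<in> A" for a
    using y that by (intro cINF_greatest assms) (force simp: algebra_simps)
  then have "y - (INF b\<in>B. g b) \<le> (INF a\<in>A. f a)"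
    by (intro cINF_greatest assms) (force simp: algebra_simps)
  then show "y \<le> (INF a\<in>A. f a) + (INF b\<in>B. g b)" by simp
qed (use assms in \<open>auto intro!: add_mono cINF_lower\<close>)

lemma mixed_strategies_nonempty: "n > 0 \<Longrightarrow> mixed_strategies n \<noteq> {}"
  by (auto simp: mixed_strategies_def intro!: exI[of _ "return_pmf 0"])

lemma finite_set_mixed_strategies: "p \<in> mixed_strategies n \<Longrightarrow> finite (set_pmf p)"
  by (auto simp: mixed_strategies_def intro: finite_subset)

lemma mixed_strategies_1: "mixed_strategies 1 = {return_pmf 0}"
  by (auto simp: mixed_strategies_def set_pmf_subset_singleton lessThan_Suc)

lemma mult_add_less:
  fixes i k :: nat
  assumes "i < m" "k < n"
  shows "i * n + k < m * n"
proof -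
  have "i * n + k < Suc i * n" using assms by simp
  also have "\<dots> \<le> m * n" using assms by (intro mult_le_mono1) simp
  finally show ?thesis .
qed

text \<open>Serves to reindex an optimization over strategies of the sum by pairs of marginals.
  Since \<open>k\<close> encodes the pair \<open>(k div n, k mod n)\<close>, the two maps are the
  marginals; independent play shows that every pair is attained.\<close>

lemma marginals_mixed_strategies:
  assumes "n > 0"
  shows "(\<lambda>p. (map_pmf (\<lambda>k. k div n) p, map_pmf (\<lambda>k. k mod n) p)) ` mixed_strategies (m * n) =
         mixed_strategies m \<times> mixed_strategies n" (is "?f ` _ = _")
proof (intro equalityI subsetI)
  fix x assume "x \<in> ?f ` mixed_strategies (m * n)"
  then show "x \<in> mixed_strategies m \<times> mixed_strategies n"
    using assms by (fastforce simp: mixed_strategies_def less_mult_imp_div_less)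
next
  fix x assume "x \<in> mixed_strategies m \<times> mixed_strategies n"
  then obtain p q where x: "x = (p, q)" and p: "set_pmf p \<subseteq> {..<m}" and q: "set_pmf q \<subseteq> {..<n}"
    by (auto simp: mixed_strategies_def)
  let ?r = "map_pmf (\<lambda>(i, k). i * n + k) (pair_pmf p q)"
  \<comment> \<open>Equality is needed only on the support, where the second coordinate is below
    \<open>n\<close>, so that \<open>div\<close> and \<open>mod\<close> decode
    \<open>i * n + k\<close> correctly.\<close>
  have "map_pmf (\<lambda>k. k div n) ?r = map_pmf fst (pair_pmf p q)"
    unfolding map_pmf_comp using q by (intro map_pmf_cong) auto
  moreover have "map_pmf (\<lambda>k. k mod n) ?r = map_pmf snd (pair_pmf p q)"
    unfolding map_pmf_comp using q by (intro map_pmf_cong) auto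
  ultimately have "x = ?f ?r"
    by (simp add: x map_fst_pair_pmf map_snd_pair_pmf)
  moreover have "?r \<in> mixed_strategies (m * n)"
    using p q by (auto simp: mixed_strategies_def intro!: mult_add_less)
  ultimately show "x \<in> ?f ` mixed_strategies (m * n)" by blast
qed

text \<open>A payoff is an average of finitely many entries, so one bound serves all strategies. It
  makes the infima and suprema below well behaved.\<close>

lemma expected_payoff_bounded:
  obtains K where "\<And>p q. p \<in> mixed_strategies m \<Longrightarrow> q \<in> mixed_strategies n \<Longrightarrow>
    \<bar>expected_payoff A p q\<bar> \<le> K"
proof
  fix p q assume p: "p \<in> mixed_strategies m" and q: "q \<in> mixed_strategies n"
  \<comment> \<open>A sum of absolute values, unlike a maximum, makes sense for an empty matrix
    too.\<close>
  let ?K = "\<Sum>(i, j)\<in>{..<m} \<times> {..<n}. \<bar>A i j\<bar>"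
  have "\<bar>A i j\<bar> \<le> ?K" if "i < m" "j < n" for i j
    using that member_le_sum[of "(i, j)" "{..<m} \<times> {..<n}" "\<lambda>(i, j). \<bar>A i j\<bar>"] by auto
  then have *: "AE x in pair_pmf p q. \<bar>case x of (i, j) \<Rightarrow> A i j\<bar> \<le> ?K"
    using p q by (auto simp: AE_measure_pmf_iff mixed_strategies_def)
  have int: "integrable (pair_pmf p q) (\<lambda>(i, j). A i j)"
    using p q by (intro integrable_measure_pmf_finite) (auto dest: finite_set_mixed_strategies)
  have "expected_payoff A p q \<le> ?K" unfolding expected_payoff_def
    by (intro measure_pmf.integral_le_const int eventually_mono[OF *]) auto
  moreover have "- ?K \<le> expected_payoff A p q" unfolding expected_payoff_def
    by (intro measure_pmf.integral_ge_const int eventually_mono[OF *]) auto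
  ultimately show "\<bar>expected_payoff A p q\<bar> \<le> ?K" by simp
qed

lemma bdd_below_expected_payoff:
  assumes "p \<in> mixed_strategies m"
  shows "bdd_below (expected_payoff A p ` mixed_strategies n)"
proof -
  obtain K where "\<And>p q. p \<in> mixed_strategies m \<Longrightarrow> q \<in> mixed_strategies n \<Longrightarrow>
      \<bar>expected_payoff A p q\<bar> \<le> K"
    using expected_payoff_bounded[of m n A] by blast
  with assms show ?thesis by (intro bdd_belowI2[where m = "- K"]) (simp add: abs_le_iff minus_le_iff)
qed

text \<open>Any single reply \<open>q\<close> bounds the infimum from above, uniformly in
  \<open>p\<close>; \<open>n > 0\<close> provides such a reply.\<close>

lemma bdd_above_INF_expected_payoff:
  assumes "n > 0"
  shows "bdd_above ((\<lambda>p. INF q\<in>mixed_strategies n. expected_payoff A p q) ` mixed_strategies m)"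
proof -
  obtain K where K: "\<And>p q. p \<in> mixed_strategies m \<Longrightarrow> q \<in> mixed_strategies n \<Longrightarrow>
      \<bar>expected_payoff A p q\<bar> \<le> K"
    using expected_payoff_bounded[of m n A] by blast
  obtain q where q: "q \<in> mixed_strategies n" using mixed_strategies_nonempty[OF assms] by blast
  show ?thesis
  proof (rule bdd_aboveI2)
    fix p assume p: "p \<in> mixed_strategies m"
    show "(INF q\<in>mixed_strategies n. expected_payoff A p q) \<le> K"
      by (rule cINF_lower2[OF bdd_below_expected_payoff[OF p] q]) (use K[OF p q] in simp)
  qed
qed

text \<open>Linearity of expectation, with finite supports giving integrability. As the players
  randomize independently of each other, pushing the product of \<open>p\<close> and
  \<open>q\<close> forward along \<open>f\<close> and \<open>g\<close> gives the product of the
  images. Any correlation inside \<open>p\<close> or \<open>q\<close> between the components is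
  invisible.\<close>

lemma expected_payoff_sum:
  assumes "finite (set_pmf p)" "finite (set_pmf q)"
  shows "expected_payoff (\<lambda>i j. A (f i) (g j) + B (f' i) (g' j)) p q =
    expected_payoff A (map_pmf f p) (map_pmf g q) +
    expected_payoff B (map_pmf f' p) (map_pmf g' q)"
proof -
  have "integrable (pair_pmf p q) h" for h :: "nat \<times> nat \<Rightarrow> real"
    using assms by (intro integrable_measure_pmf_finite) simp
  then show ?thesis
    by (simp add: expected_payoff_def case_prod_unfold flip: map_pair)
qed

lemma matrix_game_value_sum:
  assumes pos: "m > 0" "n > 0" "m' > 0" "n' > 0"
  shows "matrix_game_value (m * m') (n * n')
      (\<lambda>i j. A (i div m') (j div n') + B (i mod m') (j mod n')) =
    matrix_game_value m n A + matrix_game_value m' n' B" (is "matrix_game_value _ _ ?C = _")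
proof -
  \<comment> \<open>\<open>a\<close> and \<open>b\<close> are the payoffs that a row strategy
    guarantees in the two components.\<close>
  define a where "a p = (INF q\<in>mixed_strategies n. expected_payoff A p q)" for p
  define b where "b p = (INF q\<in>mixed_strategies n'. expected_payoff B p q)" for p
  have INF: "(INF q\<in>mixed_strategies (n * n'). expected_payoff ?C p q) =
      a (map_pmf (\<lambda>i. i div m') p) + b (map_pmf (\<lambda>i. i mod m') p)"
    if p: "p \<in> mixed_strategies (m * m')" for p
  proof -
    let ?p1 = "map_pmf (\<lambda>i. i div m') p" and ?p2 = "map_pmf (\<lambda>i. i mod m') p"
    have p12: "?p1 \<in> mixed_strategies m" "?p2 \<in> mixed_strategies m'"
      using p marginals_mixed_strategies[OF \<open>m' > 0\<close>, of m] by blast+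
    \<comment> \<open>The payoff is written as a function of the pair of marginals of
      \<open>q\<close>, so that the infimum becomes one over the image of the marginal map, which is
      a full product.\<close>
    have "(INF q\<in>mixed_strategies (n * n'). expected_payoff ?C p q) =
        (INF q\<in>mixed_strategies (n * n').
          (\<lambda>(q1, q2). expected_payoff A ?p1 q1 + expected_payoff B ?p2 q2)
            (map_pmf (\<lambda>j. j div n') q, map_pmf (\<lambda>j. j mod n') q))"
      using p by (intro INF_cong) 
        (auto dest!: finite_set_mixed_strategies
          intro!: expected_payoff_sum[where A = A and B = B and f = "\<lambda>i. i div m'"
            and g = "\<lambda>j. j div n'" and f' = "\<lambda>i. i mod m'" and g' = "\<lambda>j. j mod n'"])
    also have "\<dots> = (INF (q1, q2)\<in>mixed_strategies n \<times> mixed_strategies n'.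
        expected_payoff A ?p1 q1 + expected_payoff B ?p2 q2)"
      unfolding marginals_mixed_strategies[OF \<open>n' > 0\<close>, symmetric] image_image ..
    also have "\<dots> = a ?p1 + b ?p2"
      unfolding a_def b_def using pos p12
      by (intro cINF_add_Times mixed_strategies_nonempty bdd_below_expected_payoff)
    finally show ?thesis .
  qed
  \<comment> \<open>The same reindexing, now for the row player.\<close>
  have "matrix_game_value (m * m') (n * n') ?C =
      (SUP p\<in>mixed_strategies (m * m').
        (\<lambda>(p1, p2). a p1 + b p2) (map_pmf (\<lambda>i. i div m') p, map_pmf (\<lambda>i. i mod m') p))"
    unfolding matrix_game_value_def by (intro SUP_cong) (auto simp: INF)
  also have "\<dots> = (SUP (p1, p2)\<in>mixed_strategies m \<times> mixed_strategies m'. a p1 + b p2)"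
    unfolding marginals_mixed_strategies[OF \<open>m' > 0\<close>, symmetric] image_image ..
  also have "\<dots> = matrix_game_value m n A + matrix_game_value m' n' B"
    unfolding matrix_game_value_def a_def b_def using pos
    by (intro cSUP_add_Times mixed_strategies_nonempty bdd_above_INF_expected_payoff)
  finally show ?thesis .
qed

lemma matrix_game_value_const_1: "matrix_game_value 1 1 (\<lambda>_ _. c) = c"
  unfolding matrix_game_value_def mixed_strategies_1 by (simp add: expected_payoff_def)

text \<open>The case \<open>m' = n' = 1\<close> of the sum: \<open>div 1\<close> keeps an index and
  \<open>mod 1\<close> sends it to 0.\<close>

lemma matrix_game_value_add_const:
  assumes "m > 0" "n > 0"
  shows "matrix_game_value m n (\<lambda>i j. A i j + c) = matrix_game_value m n A + c"
  using matrix_game_value_sum[OF assms, of 1 1 A "\<lambda>_ _. c"] matrix_game_value_const_1[of c]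
  by simp

text \<open>Supplies the positive dimensions that the results on matrix games require.\<close>

lemma not_terminal_iff:
  "\<not> terminal G \<longleftrightarrow> left_opts G \<noteq> [] \<and> right_opts G \<noteq> []"
  by (auto simp: terminal_def sim_opts_def)

text \<open>Phrased with selectors, so that it applies to a sum without inspecting its
  constructor.\<close>

lemma Ex_rec:
  "Ex G = (if terminal G then real_of_int (score G) else
    matrix_game_value (length (left_opts G)) (length (right_opts G)) (\<lambda>i j. Ex (sim_opt G i j)))"
proof (cases G)
  case End
  then show ?thesis by (simp add: Ex_def terminal_def sim_opts_def)
qed (simp add: Ex_def)

lemma Ex_terminal: "terminal G \<Longrightarrow> Ex G = real_of_int (score G)"
  by (simp add: Ex_rec)

lemma Ex_End: "Ex (End s) = real_of_int s"
  by (simp add: Ex_def)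

lemma Ex_conj_sum: "Ex (G \<bigtriangledown> H) = Ex G + Ex H"
\<comment> \<open>Following the recursion of the sum gives, in each branch, the hypothesis for
  exactly the sums occurring as simultaneous options there.\<close>
proof (induction G H rule: conj_sum.induct)
  case (1 G H)
  let ?m = "length (left_opts G)" and ?n = "length (right_opts G)"
  let ?m' = "length (left_opts H)" and ?n' = "length (right_opts H)"
  show ?case
  proof (cases "terminal G"; cases "terminal H")
    assume "terminal G" "terminal H"
    then show ?thesis
      by (simp add: Ex_terminal Ex_End conj_sum.simps[of G H])
  next
    assume G: "\<not> terminal G" and H: "terminal H"
    then have sum: "length (left_opts (G \<bigtriangledown> H)) = ?m"
        "length (right_opts (G \<bigtriangledown> H)) = ?n"
        "\<And>i j. sim_opt (G \<bigtriangledown> H) i j = sim_opt G i j \<bigtriangledown> H"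
      by (simp_all add: conj_sum.simps[of G H])
    \<comment> \<open>The sum inherits the strategy counts of \<open>G\<close>, which are
      positive.\<close>
    have nt: "\<not> terminal (G \<bigtriangledown> H)"
      using G H by (simp add: not_terminal_iff sum flip: length_greater_0_conv)
    have IH: "Ex (sim_opt G i j \<bigtriangledown> H) = Ex (sim_opt G i j) + Ex H" for i j
      using 1 G H by blast
    show ?thesis
      unfolding Ex_rec[of "G \<bigtriangledown> H"] Ex_rec[of G] sum IH
      using G nt by (simp add: matrix_game_value_add_const not_terminal_iff[THEN iffD1])
  next
    assume G: "terminal G" and H: "\<not> terminal H"
    then have sum: "length (left_opts (G \<bigtriangledown> H)) = ?m'"
        "length (right_opts (G \<bigtriangledown> H)) = ?n'"
        "\<And>i j. sim_opt (G \<bigtriangledown> H) i j = G \<bigtriangledown> sim_opt H i j"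
      by (simp_all add: conj_sum.simps[of G H])
    have nt: "\<not> terminal (G \<bigtriangledown> H)"
      using G H by (simp add: not_terminal_iff sum flip: length_greater_0_conv)
    \<comment> \<open>The summands are swapped to put the constant \<open>Ex G\<close> on the right,
      as in \<open>matrix_game_value_add_const\<close>.\<close>
    have IH: "Ex (G \<bigtriangledown> sim_opt H i j) = Ex (sim_opt H i j) + Ex G" for i j
      using 1 G H by (metis add.commute)
    show ?thesis
      unfolding Ex_rec[of "G \<bigtriangledown> H"] Ex_rec[of H] sum IH
      using H nt by (simp add: matrix_game_value_add_const not_terminal_iff[THEN iffD1])
  next
    assume G: "\<not> terminal G" and H: "\<not> terminal H"
    then have sum: "length (left_opts (G \<bigtriangledown> H)) = ?m * ?m'"
        "length (right_opts (G \<bigtriangledown> H)) = ?n * ?n'"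
        "\<And>i j. sim_opt (G \<bigtriangledown> H) i j =
          sim_opt G (i div ?m') (j div ?n') \<bigtriangledown> sim_opt H (i mod ?m') (j mod ?n')"
      by (simp_all add: conj_sum.simps[of G H])
    have nt: "\<not> terminal (G \<bigtriangledown> H)"
      using G H by (simp add: not_terminal_iff sum flip: length_greater_0_conv)
    have IH: "Ex (sim_opt G (i div ?m') (j div ?n') \<bigtriangledown> sim_opt H (i mod ?m') (j mod ?n')) =
        Ex (sim_opt G (i div ?m') (j div ?n')) + Ex (sim_opt H (i mod ?m') (j mod ?n'))" for i j
      using 1 G H by blast
    show ?thesis
      \<comment> \<open>By the induction hypothesis the matrix of the sum now has the
        \<open>div\<close>/\<open>mod\<close> form of \<open>matrix_game_value_sum\<close>.\<close>
      unfolding Ex_rec[of "G \<bigtriangledown> H"] Ex_rec[of G] Ex_rec[of H] sum IH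
      using G H nt
        matrix_game_value_sum[of ?m ?n ?m' ?n' "\<lambda>i j. Ex (sim_opt G i j)" "\<lambda>k l. Ex (sim_opt H k l)"]
      by (simp add: not_terminal_iff[THEN iffD1])
  qed
qed

text \<open>Additivity gives the order claim: a test game \<open>X\<close> adds the same
  \<open>Ex X\<close> to both sides.\<close>

theorem theorem4p1:
  fixes G H :: game
  shows "Ex (G \<bigtriangledown> H) = Ex G + Ex H \<and> (Ex G \<ge> Ex H \<longrightarrow> game_ge Ex G H)"
  by (simp add: game_ge_def Ex_conj_sum)

end
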